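(* Let $(S,\mathfrak m)$ be a regular local ring of dimension two, let $I$ be an $\mathfrak m$-primary ideal of $S$, and let $d=\mu(I)-2$ be its deviation. Then $\mathfrak m^{d}\not\subset I$.
   Context: $\mu(I)$ denotes the minimal number of generators of $I$. The convention is $\mathfrak m^0=S$. *)

theory Defs
  imports
    "HOL-Algebra.Ideal_Product"
    "HOL-Algebra.Ring_Divisibility"
    "HOL-Library.Extended_Nat"
begin

(* Supremum of the lengths n of strict chains P 0 < ... < P n of prime ideals.
   The zero ring has no prime ideals and gets dimension Sup {} = 0 here; local rings are nonzero. *)
definition krull_dim :: "('a, 'b) ring_scheme \<Rightarrow> enat" where
  "krull_dim R = Sup {enat n | n. \<exists>P :: nat \<Rightarrow> 'a set.
     (\<forall>i\<le>n. primeideal (P i) R) \<and> (\<forall>i<n. P i \<subset> P (Suc i))}"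

(* Only meaningful for finitely generated ideals, hence for every ideal of a Noetherian ring. *)
definition min_gens :: "('a, 'b) ring_scheme \<Rightarrow> 'a set \<Rightarrow> nat" where
  "min_gens R I = (LEAST n. \<exists>A \<subseteq> carrier R. finite A \<and> card A = n \<and> I = Idl\<^bsub>R\<^esub> A)"

locale local_ring = cring R + maximalideal \<mm> R for R (structure) and \<mm> +
  assumes unique_maximal: "maximalideal J R \<Longrightarrow> J = \<mm>"

locale regular_local_ring = local_ring R \<mm> + noetherian_ring R for R (structure) and \<mm> +
  assumes regular: "enat (min_gens R \<mm>) = krull_dim R"

definition radical :: "('a, 'b) ring_scheme \<Rightarrow> 'a set \<Rightarrow> 'a set" where
  "radical R I = {x \<in> carrier R. \<exists>n::nat. n > 0 \<and> x [^]\<^bsub>R\<^esub> n \<in> I}"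

locale primaryideal = ideal I R + cring R for I and R (structure) +
  assumes I_notcarr: "carrier R \<noteq> I"
    and I_primary: "\<lbrakk>a \<in> carrier R; b \<in> carrier R; a \<otimes> b \<in> I; a \<notin> I\<rbrakk>
      \<Longrightarrow> \<exists>n::nat. n > 0 \<and> b [^] n \<in> I"

definition primary_to :: "('a, 'b) ring_scheme \<Rightarrow> 'a set \<Rightarrow> 'a set \<Rightarrow> bool" where
  "primary_to R P I \<longleftrightarrow> primaryideal I R \<and> radical R I = P"

(* Powers of ideals are powers in the multiplicative monoid of ideals, whose unit is the whole
   ring; in particular the zeroth power of any ideal is the unit ideal. *)
abbreviation ideal_power :: "('a, 'b) ring_scheme \<Rightarrow> 'a set \<Rightarrow> nat \<Rightarrow> 'a set" where
  "ideal_power R I n \<equiv> I [^]\<^bsub>ideals_set R\<^esub> n"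

lemma ideal_power_0: "ideal_power R I 0 = carrier R"
  by (simp add: nat_pow_def ideals_set_def)

lemma ideal_power_Suc: "ideal_power R I (Suc n) = ideal_prod R (ideal_power R I n) I"
  by (simp add: nat_pow_def ideals_set_def)

end

theory Submission
  imports Defs
begin

text \<open>
  The theorem is the bound \<open>\<mu>(I) \<le> d + 1\<close> for every ideal \<open>I\<close> that contains \<open>\<mm>\<^sup>d\<close>: applied
  with \<open>d = \<mu>(I) - 2\<close> it is absurd as soon as \<open>\<mu>(I) \<ge> 2\<close>, and for smaller \<open>\<mu>(I)\<close> the
  truncated difference is \<open>0\<close>, so that \<open>\<mm>\<^sup>0 \<subseteq> I\<close> contradicts the properness of \<open>I\<close>.

  The bound is usually read off from the Hilbert--Burch theorem, but it has an elementary proof.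
  Write \<open>\<mm> = (x, y)\<close>. Modulo \<open>x\<close> the maximal ideal is generated by \<open>y\<close> alone, so every ideal that
  contains a power of \<open>y\<close> is, modulo \<open>x\<close>, generated by a power of \<open>y\<close>
  (\<open>ideal_eq_Idl_power_mod\<close>). Lifting such a generator for \<open>I + (x)\<close> to some \<open>f \<in> I\<close> gives
  \<open>I = (f) + (I \<inter> (x)) = (f) + x(I : x)\<close> (\<open>split_off_generator\<close>). The colon ideal \<open>I : x\<close>
  contains \<open>\<mm>\<^bsup>d-1\<^esup>\<close>, so induction on \<open>d \<ge> 1\<close> provides \<open>d\<close> generators for it, and their
  multiples by \<open>x\<close> together with \<open>f\<close> generate \<open>I\<close>; for \<open>d = 0\<close> the ideal is generated by \<open>1\<close>
  (\<open>generated_by_Suc_of_ideal_power_subset\<close>).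

  Regularity and dimension two are what makes \<open>\<mm>\<close> generated by two elements; from there on the
  argument takes place in a commutative ring with a maximal ideal \<open>(x, y)\<close>.
\<close>

section \<open>Sums, colons and powers of ideals\<close>

lemma (in cring) in_add_PIdl_iff:
  "z \<in> J <+>\<^bsub>R\<^esub> PIdl x \<longleftrightarrow> (\<exists>i\<in>J. \<exists>r\<in>carrier R. z = i \<oplus> r \<otimes> x)"
  unfolding set_add_def' cgenideal_def by blast

lemma (in cring)
  assumes "ideal J R" "x \<in> carrier R"
  shows add_PIdl_ideal: "ideal (J <+>\<^bsub>R\<^esub> PIdl x) R"
    and subset_add_PIdl: "J \<subseteq> J <+>\<^bsub>R\<^esub> PIdl x"
    and generator_in_add_PIdl: "x \<in> J <+>\<^bsub>R\<^esub> PIdl x"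
proof -
  interpret J: ideal J R by fact
  show "ideal (J <+>\<^bsub>R\<^esub> PIdl x) R"
    using add_ideals[OF assms(1) cgenideal_ideal[OF assms(2)]] .
  have "z = z \<oplus> \<zero> \<otimes> x" if "z \<in> J" for z
    using that assms(2) J.Icarr by simp
  then show "J \<subseteq> J <+>\<^bsub>R\<^esub> PIdl x"
    unfolding subset_iff in_add_PIdl_iff using zero_closed by meson
  have "x = \<zero> \<oplus> \<one> \<otimes> x"
    using assms(2) by simp
  then show "x \<in> J <+>\<^bsub>R\<^esub> PIdl x"
    unfolding in_add_PIdl_iff using one_closed J.zero_closed by meson
qed

lemma (in cring) in_Idl_pairE:
  assumes "x \<in> carrier R" "y \<in> carrier R" "g \<in> Idl {x, y}"
  obtains r s where "r \<in> carrier R" "s \<in> carrier R" "g = r \<otimes> x \<oplus> s \<otimes> y"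
proof -
  note PIdl = cgenideal_ideal[OF assms(1)]
  have "Idl {x, y} \<subseteq> PIdl x <+>\<^bsub>R\<^esub> PIdl y"
    using genideal_minimal[OF add_PIdl_ideal[OF PIdl assms(2)], of "{x, y}"]
      subset_add_PIdl[OF PIdl assms(2)] generator_in_add_PIdl[OF PIdl assms(2)]
      cgenideal_self[OF assms(1)]
    by blast
  then obtain i s where "i \<in> PIdl x" "s \<in> carrier R" "g = i \<oplus> s \<otimes> y"
    using assms(3) in_add_PIdl_iff by blast
  then show thesis
    using that unfolding cgenideal_def by blast
qed

lemma (in cring) colon_ideal:
  assumes "ideal I R" "x \<in> carrier R"
  shows "ideal {t \<in> carrier R. x \<otimes> t \<in> I} R"
proof -
  interpret I: ideal I R by fact
  show ?thesis
  proof (rule idealI)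
    show "subgroup {t \<in> carrier R. x \<otimes> t \<in> I} (add_monoid R)"
      using assms(2)
      by (intro subgroup.intro)
        (auto simp: r_distr r_minus simp flip: a_inv_def)
  next
    fix a b assume a: "a \<in> {t \<in> carrier R. x \<otimes> t \<in> I}" and b: "b \<in> carrier R"
    have "b \<otimes> (x \<otimes> a) \<in> I"
      using a b I.I_l_closed by simp
    moreover have "x \<otimes> (b \<otimes> a) = b \<otimes> (x \<otimes> a)"
      using a b assms(2) by (simp add: m_lcomm)
    ultimately show "b \<otimes> a \<in> {t \<in> carrier R. x \<otimes> t \<in> I}"
      using a b by simp
    then show "a \<otimes> b \<in> {t \<in> carrier R. x \<otimes> t \<in> I}"
      using a b by (simp add: m_comm)
  qed (rule ring_axioms)
qed

lemma (in cring) ideal_power_ideal: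
  assumes "ideal J R"
  shows "ideal (ideal_power R J n) R"
  by (induction n)
    (simp_all only: ideal_power_0 ideal_power_Suc oneideal ideal_prod_is_ideal assms)

lemma (in cring) pow_in_ideal_power:
  assumes "y \<in> J"
  shows "y [^] n \<in> ideal_power R J n"
  by (induction n)
    (simp_all only: ideal_power_0 ideal_power_Suc nat_pow_0 nat_pow_Suc one_closed
      ideal_prod.prod assms)

section \<open>Ideals modulo one of two generators of a maximal ideal\<close>

text \<open>
  Since \<open>(x, y) + (u)\<close> is the whole ring, there is an equation \<open>1 = p x + q y + r u\<close>. Multiplied by
  \<open>y\<^sup>k\<close> it writes \<open>y\<^sup>k\<close> as a combination of \<open>x\<close>, \<open>y\<^bsup>k+1\<^esup>\<close> and \<open>u y\<^sup>k\<close>. This replaces division by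
  \<open>u\<close>, which need not be a unit when \<open>(x, y)\<close> is not the only maximal ideal.
\<close>

lemma (in cring) cancel_nonmember_of_maximal:
  assumes max: "maximalideal (Idl {x, y}) R" and xy: "x \<in> carrier R" "y \<in> carrier R"
    and J: "ideal J R" "x \<in> J"
    and u: "u \<in> carrier R" "u \<notin> Idl {x, y}"
    and uy: "u \<otimes> y [^] k \<in> J" and Suc_k: "y [^] Suc k \<in> J"
  shows "y [^] k \<in> J"
proof -
  interpret M: maximalideal "Idl {x, y}" R by fact
  interpret J: ideal J R by fact
  let ?K = "Idl {x, y} <+>\<^bsub>R\<^esub> PIdl u"
  have K: "ideal ?K R" "Idl {x, y} \<subseteq> ?K" "u \<in> ?K"
    using add_PIdl_ideal subset_add_PIdl generator_in_add_PIdl M.is_ideal u(1) by blast+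
  then have "?K = carrier R"
    using M.I_maximal[of ?K] u(2) ideal.Icarr[OF K(1)] by blast
  then obtain n r where nr: "n \<in> Idl {x, y}" "r \<in> carrier R" "\<one> = n \<oplus> r \<otimes> u"
    using one_closed in_add_PIdl_iff by metis
  from in_Idl_pairE[OF xy nr(1)] obtain p q
    where pq: "p \<in> carrier R" "q \<in> carrier R" "n = p \<otimes> x \<oplus> q \<otimes> y" .
  define w where "w = y [^] k"
  have w: "w \<in> carrier R" using xy by (simp add: w_def)
  have "w = (p \<otimes> x \<oplus> q \<otimes> y \<oplus> r \<otimes> u) \<otimes> w"
    using nr(3) pq w l_one by metis
  also have "\<dots> = (p \<otimes> w) \<otimes> x \<oplus> q \<otimes> (w \<otimes> y) \<oplus> r \<otimes> (u \<otimes> w)"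
    using w xy u(1) nr(2) pq by algebra
  also have "\<dots> \<in> J"
    using J uy Suc_k pq nr(2) w by (auto simp flip: w_def intro!: J.a_closed J.I_l_closed)
  finally show ?thesis unfolding w_def .
qed

text \<open>
  In other words, all ideals of \<open>R/(x)\<close> that contain a power of \<open>y\<close> are generated by a power of \<open>y\<close>,
  as in a discrete valuation ring. The exponent is the least \<open>a\<close> with \<open>y\<^sup>a \<in> J\<close>: if \<open>g \<in> J\<close> is
  congruent to \<open>c y\<^sup>j\<close> modulo \<open>x\<close> with \<open>j < a\<close>, then \<open>c\<close> lies in \<open>(x, y)\<close>, since otherwise a smaller
  power of \<open>y\<close> would lie in \<open>J\<close>; so \<open>g\<close> is congruent to a multiple of \<open>y\<^bsup>j+1\<^esup>\<close>.
\<close>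

lemma (in cring) ideal_eq_Idl_power_mod:
  assumes max: "maximalideal (Idl {x, y}) R" and xy: "x \<in> carrier R" "y \<in> carrier R"
    and J: "ideal J R" "x \<in> J" and pow: "y [^] (d::nat) \<in> J"
  obtains a :: nat where "J = Idl {x, y [^] a}"
proof -
  interpret J: ideal J R by fact
  define a where "a = (LEAST n::nat. y [^] n \<in> J)"
  have a: "y [^] a \<in> J"
    unfolding a_def by (rule LeastI[of "\<lambda>n. y [^] n \<in> J", OF pow])
  have least: "y [^] n \<notin> J" if "n < a" for n :: nat
    by (rule not_less_Least[of n "\<lambda>n. y [^] n \<in> J", folded a_def, OF that])
  have divide: "\<exists>s\<in>carrier R. \<exists>c\<in>carrier R. g = s \<otimes> x \<oplus> c \<otimes> y [^] j"
    if g: "g \<in> J" and "j \<le> a" for g j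
    using \<open>j \<le> a\<close>
  proof (induction j)
    case 0
    have "g = \<zero> \<otimes> x \<oplus> g \<otimes> y [^] (0::nat)" using g J.Icarr xy by simp
    then show ?case using J.Icarr[OF g] zero_closed by (intro bexI)
  next
    case (Suc j)
    then have "\<exists>s\<in>carrier R. \<exists>c\<in>carrier R. g = s \<otimes> x \<oplus> c \<otimes> y [^] j"
      by (simp only: Suc_leD)
    then obtain s c
      where sc: "s \<in> carrier R" "c \<in> carrier R" "g = s \<otimes> x \<oplus> c \<otimes> y [^] j"
      by (elim bexE)
    define w where "w = y [^] j"
    have w: "w \<in> carrier R" using xy by (simp add: w_def)
    have g_eq: "g = s \<otimes> x \<oplus> c \<otimes> w" using sc(3) by (simp only: w_def)
    have "c \<in> Idl {x, y}"
    proof (rule ccontr)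
      assume c: "c \<notin> Idl {x, y}"
      \<comment> \<open>A factor outside \<open>(x, y)\<close> can only be cancelled just below a power of \<open>y\<close> known to lie in
        \<open>J\<close>, so the exponent is first raised from \<open>j\<close> to \<open>a - 1\<close>.\<close>
      define i where "i = a - Suc j"
      have a_eq: "a = Suc (j + i)" using Suc.prems by (simp add: i_def)
      have "c \<otimes> w = (s \<otimes> x \<oplus> c \<otimes> w) \<ominus> s \<otimes> x"
        using sc(1,2) xy(1) w by algebra
      also have "\<dots> = g \<ominus> s \<otimes> x"
        by (simp only: g_eq)
      also have "\<dots> \<in> J"
        using g J(2) sc(1) by (auto simp: a_minus_def intro!: J.a_closed J.I_l_closed)
      finally have "(c \<otimes> w) \<otimes> y [^] i \<in> J"
        by (rule J.I_r_closed) (simp add: xy)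
      then have "c \<otimes> y [^] (j + i) \<in> J"
        using sc(2) xy by (simp add: w_def m_assoc nat_pow_mult)
      then have "y [^] (j + i) \<in> J"
        using a unfolding a_eq by (rule cancel_nonmember_of_maximal[OF max xy J sc(2) c])
      then show False using least[of "j + i"] a_eq by simp
    qed
    from in_Idl_pairE[OF xy this] obtain p q
      where pq: "p \<in> carrier R" "q \<in> carrier R" "c = p \<otimes> x \<oplus> q \<otimes> y" .
    have "g = s \<otimes> x \<oplus> (p \<otimes> x \<oplus> q \<otimes> y) \<otimes> w"
      using g_eq pq(3) by simp
    also have "\<dots> = (s \<oplus> p \<otimes> w) \<otimes> x \<oplus> q \<otimes> (w \<otimes> y)"
      using pq(1,2) xy w sc(1) by algebra
    finally have "g = (s \<oplus> p \<otimes> w) \<otimes> x \<oplus> q \<otimes> y [^] Suc j"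
      by (simp add: w_def)
    moreover have "s \<oplus> p \<otimes> w \<in> carrier R" using sc(1) pq(1) w by simp
    ultimately show ?case using pq(2) by (intro bexI)
  qed
  have "J = Idl {x, y [^] a}"
  proof
    interpret K: ideal "Idl {x, y [^] a}" R
      using xy by (intro genideal_ideal) auto
    have K: "x \<in> Idl {x, y [^] a}" "y [^] a \<in> Idl {x, y [^] a}"
      using genideal_self[of "{x, y [^] a}"] xy by auto
    show "J \<subseteq> Idl {x, y [^] a}"
    proof
      fix g assume "g \<in> J"
      from divide[OF this order.refl] obtain s c
        where sc: "s \<in> carrier R" "c \<in> carrier R" "g = s \<otimes> x \<oplus> c \<otimes> y [^] a"
        by (elim bexE)
      show "g \<in> Idl {x, y [^] a}"
        unfolding sc(3) using K sc(1,2) by (intro K.a_closed K.I_l_closed)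
    qed
    show "Idl {x, y [^] a} \<subseteq> J"
      by (rule genideal_minimal[OF J(1)]) (simp add: J(2) a)
  qed
  then show thesis by (rule that)
qed

text \<open>
  The element \<open>f\<close> lifts a generator of the image of \<open>I\<close> in \<open>R/(x)\<close>, so \<open>g\<close> differs from a multiple
  of \<open>f\<close> by an element of \<open>I \<inter> (x) = x(I : x)\<close>.
\<close>

lemma (in cring) split_off_generator:
  assumes max: "maximalideal (Idl {x, y}) R" and xy: "x \<in> carrier R" "y \<in> carrier R"
    and I: "ideal I R" and pow: "y [^] (d::nat) \<in> I"
  obtains f where "f \<in> I"
    "\<forall>g\<in>I. \<exists>c\<in>carrier R. \<exists>t\<in>carrier R. x \<otimes> t \<in> I \<and> g = c \<otimes> f \<oplus> x \<otimes> t"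
proof -
  interpret I: ideal I R by fact
  define J where "J = I <+>\<^bsub>R\<^esub> PIdl x"
  have J: "ideal J R" "I \<subseteq> J" "x \<in> J"
    unfolding J_def using add_PIdl_ideal subset_add_PIdl generator_in_add_PIdl I xy(1) by blast+
  have "y [^] d \<in> J"
    using J(2) pow by blast
  from ideal_eq_Idl_power_mod[OF max xy J(1,3) this] obtain a :: nat
    where J_eq: "J = Idl {x, y [^] a}" .
  define w where "w = y [^] a"
  have w: "w \<in> carrier R" using xy by (simp add: w_def)
  have "w \<in> J"
    using J_eq genideal_self[of "{x, w}"] xy(1) w by (auto simp: w_def)
  then obtain f r where f: "f \<in> I" "r \<in> carrier R" "w = f \<oplus> r \<otimes> x"
    unfolding J_def in_add_PIdl_iff by blast
  have "\<exists>c\<in>carrier R. \<exists>t\<in>carrier R. x \<otimes> t \<in> I \<and> g = c \<otimes> f \<oplus> x \<otimes> t" if g: "g \<in> I" for g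
  proof -
    have fc: "f \<in> carrier R" "g \<in> carrier R" using f g I.Icarr by auto
    have "g \<in> Idl {x, w}" using J(2) g J_eq unfolding w_def by blast
    from in_Idl_pairE[OF xy(1) w this] obtain p c
      where pc: "p \<in> carrier R" "c \<in> carrier R" "g = p \<otimes> x \<oplus> c \<otimes> w" .
    define t where "t = p \<oplus> c \<otimes> r"
    have t: "t \<in> carrier R" using pc f by (simp add: t_def)
    have "g = p \<otimes> x \<oplus> c \<otimes> (f \<oplus> r \<otimes> x)"
      using pc(3) f(3) by simp
    also have "\<dots> = c \<otimes> f \<oplus> x \<otimes> t"
      unfolding t_def using pc(1,2) f(2) fc(1) xy(1) by algebra
    finally have g_eq: "g = c \<otimes> f \<oplus> x \<otimes> t" .
    have "x \<otimes> t = (c \<otimes> f \<oplus> x \<otimes> t) \<ominus> c \<otimes> f"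
      using pc(2) fc(1) t xy(1) by algebra
    also have "\<dots> = g \<ominus> c \<otimes> f"
      by (simp only: g_eq)
    also have "\<dots> \<in> I"
      using g f(1) pc(2) by (auto simp: a_minus_def intro!: I.a_closed I.I_l_closed)
    finally show ?thesis
      using g_eq pc(2) t by (intro bexI conjI)
  qed
  then show thesis by (intro that[OF f(1)] ballI)
qed

section \<open>The bound on the number of generators\<close>

text \<open>
  Each step of the induction costs the one generator \<open>f\<close> and passes from \<open>I\<close> to \<open>I : x\<close>, which
  contains \<open>(x, y)\<^sup>d\<close> because \<open>x (x, y)\<^sup>d \<subseteq> (x, y)\<^bsup>d+1\<^esup>\<close>.
\<close>

lemma (in cring) generated_by_Suc_of_ideal_power_subset:
  assumes max: "maximalideal (Idl {x, y}) R" and xy: "x \<in> carrier R" "y \<in> carrier R"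
    and "ideal I R" and "ideal_power R (Idl {x, y}) d \<subseteq> I"
  shows "\<exists>A \<subseteq> carrier R. finite A \<and> card A \<le> Suc d \<and> I = Idl A"
  using assms(4,5)
proof (induction d arbitrary: I)
  case 0
  interpret I: ideal I R by fact
  have "carrier R \<subseteq> I"
    using 0(2) unfolding ideal_power_0 .
  then have "I = Idl {\<one>}"
    using I.a_subset unfolding genideal_one by (rule subset_antisym[rotated])
  moreover have "{\<one>} \<subseteq> carrier R" "finite {\<one>}" "card {\<one>} \<le> Suc 0"
    by simp_all
  ultimately show ?case
    by (intro exI[of _ "{\<one>}"] conjI)
next
  case (Suc d)
  interpret I: ideal I R by fact
  let ?\<mm> = "Idl {x, y}"
  let ?C = "{t \<in> carrier R. x \<otimes> t \<in> I}"
  have gens: "x \<in> ?\<mm>" "y \<in> ?\<mm>" using genideal_self[of "{x, y}"] xy by auto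
  have "y [^] Suc d \<in> I"
    by (rule subsetD[OF Suc.prems(2) pow_in_ideal_power[OF gens(2)]])
  from split_off_generator[OF max xy Suc.prems(1) this] obtain f
    where f: "f \<in> I"
      "\<forall>g\<in>I. \<exists>c\<in>carrier R. \<exists>t\<in>carrier R. x \<otimes> t \<in> I \<and> g = c \<otimes> f \<oplus> x \<otimes> t" .
  have C: "ideal ?C R" by (rule colon_ideal[OF Suc.prems(1) xy(1)])
  have "ideal_power R ?\<mm> d \<subseteq> ?C"
  proof
    fix t assume t: "t \<in> ideal_power R ?\<mm> d"
    have tc: "t \<in> carrier R"
      by (rule ideal.Icarr[OF ideal_power_ideal[OF maximalideal.axioms(1)[OF max]] t])
    have "t \<otimes> x \<in> ideal_power R ?\<mm> (Suc d)"
      unfolding ideal_power_Suc using t gens(1) by (rule ideal_prod.prod)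
    then show "t \<in> ?C"
      using Suc.prems(2) tc xy(1) by (auto simp: m_comm)
  qed
  from Suc.IH[OF C this] obtain A
    where A: "A \<subseteq> carrier R" "finite A" "card A \<le> Suc d" "?C = Idl A" by (elim exE conjE)
  define B where "B = insert f ((\<otimes>) x ` A)"
  have A_C: "A \<subseteq> ?C" unfolding A(4) by (rule genideal_self[OF A(1)])
  have B_I: "B \<subseteq> I" using f(1) A_C by (auto simp: B_def)
  then have B_carr: "B \<subseteq> carrier R" using I.a_subset by (rule subset_trans)
  interpret B: ideal "Idl B" R by (rule genideal_ideal[OF B_carr])
  have B_self: "B \<subseteq> Idl B" by (rule genideal_self[OF B_carr])
  \<comment> \<open>The elements \<open>t\<close> with \<open>x t\<close> in the ideal of \<open>B\<close> form an ideal, so it is enough that \<open>A\<close> consists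
    of such elements.\<close>
  have "Idl A \<subseteq> {t \<in> carrier R. x \<otimes> t \<in> Idl B}"
    using A(1) B_self
    by (intro genideal_minimal colon_ideal B.is_ideal xy(1)) (auto simp: B_def)
  then have "?C \<subseteq> {t \<in> carrier R. x \<otimes> t \<in> Idl B}"
    unfolding A(4) .
  then have xC: "x \<otimes> t \<in> Idl B" if "t \<in> carrier R" "x \<otimes> t \<in> I" for t
    using that by auto
  have "I = Idl B"
  proof
    show "I \<subseteq> Idl B"
    proof
      fix g assume "g \<in> I"
      from bspec[OF f(2) this] obtain c t
        where ct: "c \<in> carrier R" "t \<in> carrier R" "x \<otimes> t \<in> I" "g = c \<otimes> f \<oplus> x \<otimes> t"
        by (elim bexE conjE)
      have "f \<in> Idl B" using B_self by (auto simp: B_def)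
      then show "g \<in> Idl B"
        unfolding ct(4) by (rule B.a_closed[OF B.I_l_closed[OF _ ct(1)] xC[OF ct(2,3)]])
    qed
    show "Idl B \<subseteq> I" by (rule genideal_minimal[OF Suc.prems(1) B_I])
  qed
  moreover have "finite B" using A(2) by (simp add: B_def)
  moreover have "card B \<le> Suc (Suc d)"
    using A(2,3) card_image_le[OF A(2), of "(\<otimes>) x"]
      card_insert_le_m1[of "Suc (Suc d)" "(\<otimes>) x ` A" f]
    by (simp add: B_def)
  ultimately show ?case
    using B_carr by (intro exI[of _ B] conjI)
qed

lemma min_gens_le_card:
  assumes "A \<subseteq> carrier R" "finite A"
  shows "min_gens R (Idl\<^bsub>R\<^esub> A) \<le> card A"
  unfolding min_gens_def using assms by (intro Least_le) auto

lemma (in noetherian_ring) min_gens_attained: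
  assumes "ideal I R"
  obtains A where "A \<subseteq> carrier R" "finite A" "card A = min_gens R I" "I = Idl A"
proof -
  have "\<exists>n. \<exists>A \<subseteq> carrier R. finite A \<and> card A = n \<and> I = Idl A"
    using finetely_gen[OF assms] by auto
  from LeastI_ex[OF this, folded min_gens_def] show thesis
    by (elim exE conjE) (rule that)
qed

theorem theorem2p1:
  fixes S :: "('a, 'b) ring_scheme" (structure)
    and \<mm> I :: "'a set"
    and d :: nat
  assumes "regular_local_ring S \<mm>"
    and "krull_dim S = 2"
    and "primary_to S \<mm> I"
    and "d = min_gens S I - 2"
  shows "\<not> ideal_power S \<mm> d \<subseteq> I"
proof
  assume sub: "ideal_power S \<mm> d \<subseteq> I"
  interpret regular_local_ring S \<mm> by fact
  interpret I: primaryideal I S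
    using assms(3) unfolding primary_to_def by blast
  have "enat (min_gens S \<mm>) = enat 2"
    using regular assms(2) by (simp add: numeral_eq_enat)
  then have two: "min_gens S \<mm> = 2" by simp
  obtain A where "A \<subseteq> carrier S" "card A = 2" "\<mm> = Idl A"
    using min_gens_attained[OF is_ideal] unfolding two .
  then obtain x y where xy: "x \<in> carrier S" "y \<in> carrier S" "\<mm> = Idl {x, y}"
    by (auto simp: card_2_iff)
  have "maximalideal (Idl {x, y}) S" "ideal_power S (Idl {x, y}) d \<subseteq> I"
    using is_maximalideal sub unfolding xy(3) .
  from generated_by_Suc_of_ideal_power_subset[OF this(1) xy(1,2) I.is_ideal this(2)]
  obtain B where "B \<subseteq> carrier S" "finite B" "card B \<le> Suc d" "I = Idl B"
    by (elim exE conjE)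
  then have "min_gens S I \<le> Suc d"
    using min_gens_le_card[of B S] by simp
  then have "d = 0" using assms(4) by linarith
  have "carrier S \<subseteq> I" using sub unfolding \<open>d = 0\<close> ideal_power_0 .
  then show False using I.I_notcarr I.a_subset by blast
qed

end
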